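(* Let $\alpha,\beta$ be compositions of length $R$ and size $N$ with $\alpha\ne(1^R)$. Suppose that $\lambda(\alpha)=\lambda(\beta)$, and assume that $\alpha_1\le\alpha_R$ and $\beta_1\le\beta_R$. If $r_\alpha-r_\beta$ is Schur-positive, then $\alpha_1\alpha_R\le_{lex}\beta_1\beta_R$, i.e. either $\alpha_1<\beta_1$, or $\alpha_1=\beta_1$ and $\alpha_R\le\beta_R$.
   Context: $\lambda(\alpha)$ is the partition obtained by sorting the parts of $\alpha$ decreasingly. The ribbon diagram of $\alpha=\alpha_1\cdots\alpha_R$ (English convention, rows from the top) has $\alpha_i$ cells in row $i$, with the rightmost cell of row $i+1$ directly below the leftmost cell of row $i$; $r_\alpha=\sum_T\prod_m x_m^{\#\{m\text{'s in }T\}}$ over semistandard Young tableaux $T$ of this shape (rows weakly increasing, columns strictly increasing). A symmetric function is Schur-positive if it is a nonnegative linear combination of Schur functions. *)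

theory Defs
  imports Complex_Main "HOL-Library.FuncSet" "HOL-Library.Poly_Mapping"
begin

definition compositions :: "nat \<Rightarrow> nat \<Rightarrow> nat list set" where
  "compositions R N = {\<alpha>. length \<alpha> = R \<and> sum_list \<alpha> = N \<and> (\<forall>a\<in>set \<alpha>. 0 < a)}"

definition is_partition :: "nat list \<Rightarrow> bool" where
  "is_partition \<mu> \<longleftrightarrow> sorted_wrt (\<ge>) \<mu> \<and> (\<forall>a\<in>set \<mu>. 0 < a)"

definition sort_partition :: "nat list \<Rightarrow> nat list" where
  "sort_partition \<alpha> = rev (sort \<alpha>)"

text \<open>
  A cell is a pair (row, column), with rows numbered from the top and columns from the left,
  both starting at 0. A tableau is extensional: it is \<open>undefined\<close> outside its diagram, so that
  tableaux can be counted. Entries are positive integers.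
\<close>

type_synonym cell = "nat \<times> nat"

definition semistandard_tableaux :: "cell set \<Rightarrow> (cell \<Rightarrow> nat) set" where
  "semistandard_tableaux D = {T \<in> D \<rightarrow>\<^sub>E {1..}.
     (\<forall>i j j'. (i, j) \<in> D \<and> (i, j') \<in> D \<and> j < j' \<longrightarrow> T (i, j) \<le> T (i, j')) \<and>
     (\<forall>i i' j. (i, j) \<in> D \<and> (i', j) \<in> D \<and> i < i' \<longrightarrow> T (i, j) < T (i', j))}"

text \<open>
  A formal power series in the variables \<open>x\<^sub>1, x\<^sub>2, \<dots>\<close> is given by its coefficients: a monomial is
  the finitely supported map sending \<open>k\<close> to the exponent of \<open>x\<^sub>k\<close> (\<open>x\<^sub>0\<close> is never used).
\<close>

type_synonym power_series = "(nat \<Rightarrow>\<^sub>0 nat) \<Rightarrow> real"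

definition tableau_series :: "cell set \<Rightarrow> power_series" where
  "tableau_series D m =
     real (card {T \<in> semistandard_tableaux D. \<forall>k. Poly_Mapping.lookup m k = card {c \<in> D. T c = k}})"

definition young_diagram :: "nat list \<Rightarrow> cell set" where
  "young_diagram \<mu> = {(i, j). i < length \<mu> \<and> j < \<mu> ! i}"

definition schur :: "nat list \<Rightarrow> power_series" where
  "schur \<mu> = tableau_series (young_diagram \<mu>)"

text \<open>
  The bottom row of the ribbon starts in column 0. Going up from row \<open>k\<close> to row \<open>k - 1\<close>, the
  leftmost column moves right by one less than the length of row \<open>k\<close>.
\<close>

definition ribbon_start :: "nat list \<Rightarrow> nat \<Rightarrow> nat" where
  "ribbon_start \<alpha> i = (\<Sum>k\<in>{Suc i..<length \<alpha>}. \<alpha> ! k - 1)"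

definition ribbon_diagram :: "nat list \<Rightarrow> cell set" where
  "ribbon_diagram \<alpha> =
     {(i, j). i < length \<alpha> \<and> ribbon_start \<alpha> i \<le> j \<and> j < ribbon_start \<alpha> i + \<alpha> ! i}"

lemma ribbon_rows_overlap:
  assumes "Suc i < length \<alpha>" and "0 < \<alpha> ! Suc i"
  shows "ribbon_start \<alpha> i = ribbon_start \<alpha> (Suc i) + \<alpha> ! Suc i - 1"
  using assms by (simp add: ribbon_start_def sum.atLeast_Suc_lessThan)

definition ribbon_schur :: "nat list \<Rightarrow> power_series" where
  "ribbon_schur \<alpha> = tableau_series (ribbon_diagram \<alpha>)"

definition schur_positive :: "power_series \<Rightarrow> bool" where
  "schur_positive f \<longleftrightarrow>
     (\<exists>P c. finite P \<and> (\<forall>\<mu>\<in>P. is_partition \<mu> \<and> (0::real) \<le> c \<mu>) \<and>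
            f = (\<lambda>m. \<Sum>\<mu>\<in>P. c \<mu> * schur \<mu> m))"

end

theory Submission
  imports Defs "HOL-Library.Product_Lexorder" "HOL-Computational_Algebra.Polynomial"
begin

text \<open>
  Pairing a symmetric function with \<open>e\<^bsub>R-1\<^esub> h\<^bsub>N-R+1-k\<^esub> h\<^sub>k\<close> is a functional that is nonnegative on
  Schur functions. On \<open>r\<^sub>\<alpha>\<close> it counts the tableaux that carry labels \<open>1, \<dots>, R-1\<close>, each in a lower row
  than the previous one, and otherwise two larger letters, the largest one \<open>k\<close> times. The labels sit at
  the left ends of all rows but one, and summing over the exceptional row gives, with
  \<open>[a] = 1 + q + \<dots> + q\<^bsup>a-1\<^esup>\<close> and \<open>P\<close> the product of all \<open>[\<alpha>\<^sub>i]\<close>, the generating function in \<open>q\<^sup>k\<close>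
  \<open>R P - (\<Sum>i. P / [\<alpha>\<^sub>i]) + P / [\<alpha>\<^sub>1] + q\<^bsup>\<alpha>\<^sub>R\<^esup> P / [\<alpha>\<^sub>R]\<close>. Only the last two summands depend on the order of
  the parts. As \<open>1 / [a] = (1 - q) (1 + q\<^sup>a + \<dots>)\<close>, if \<open>\<alpha>\<^sub>1\<alpha>\<^sub>R\<close> were lexicographically larger than
  \<open>\<beta>\<^sub>1\<beta>\<^sub>R\<close>, the functional would be negative on \<open>r\<^sub>\<alpha> - r\<^sub>\<beta>\<close> for \<open>k\<close> the first entry of \<open>\<beta>\<^sub>1\<beta>\<^sub>R\<close> that differs.
\<close>

section \<open>Standardization and the descent functional\<close>

definition tableaux_with_content :: "cell set \<Rightarrow> nat multiset \<Rightarrow> (cell \<Rightarrow> nat) set" where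
  "tableaux_with_content D M = {T \<in> semistandard_tableaux D. image_mset T (mset_set D) = M}"

definition monomial_of :: "nat multiset \<Rightarrow> (nat \<Rightarrow>\<^sub>0 nat)" where
  "monomial_of M = Abs_poly_mapping (count M)"

lemma lookup_monomial_of: "Poly_Mapping.lookup (monomial_of M) = count M"
proof -
  have "{x. count M x \<noteq> 0} = set_mset M"
    by auto
  then have "finite {x. count M x \<noteq> 0}"
    by simp
  then show ?thesis
    unfolding monomial_of_def by (rule lookup_Abs_poly_mapping)
qed

lemma count_image_mset_set:
  assumes "finite D"
  shows "count (image_mset T (mset_set D)) k = card {c \<in> D. T c = k}"
proof -
  have "T -` {k} \<inter> D = {c \<in> D. T c = k}"
    by auto
  then show ?thesis
    using assms by (simp add: count_image_mset)
qed

lemma tableau_series_monomial_of: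
  assumes "finite D"
  shows "tableau_series D (monomial_of M) = real (card (tableaux_with_content D M))"
  using assms unfolding tableau_series_def tableaux_with_content_def lookup_monomial_of
  by (simp add: multiset_eq_iff count_image_mset_set eq_commute)

text \<open>At such an \<open>i\<close> the letters \<open>i\<close> and \<open>Suc i\<close> can be
  merged without breaking a column. In a standard tableau the complement is the usual descent
  set.\<close>

definition ascents :: "cell set \<Rightarrow> (cell \<Rightarrow> nat) \<Rightarrow> nat set" where
  "ascents D T = {i. \<forall>c\<in>D. \<forall>c'\<in>D. T c = i \<and> T c' = Suc i \<longrightarrow> snd c < snd c'}"

text \<open>Merges \<open>t\<close> with \<open>Suc t\<close> for every \<open>t\<close> in
  \<open>U\<close> and names each block by its smallest letter. Nothing is renumbered, so merged
  monomials may skip variables.\<close>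

definition collapse :: "nat set \<Rightarrow> nat \<Rightarrow> nat" where
  "collapse U i = (LEAST j. {j..<i} \<subseteq> U)"

lemma collapse_subset: "{collapse U i..<i} \<subseteq> U"
  unfolding collapse_def by (rule LeastI[of _ i]) simp

lemma collapse_least: "{j..<i} \<subseteq> U \<Longrightarrow> collapse U i \<le> j"
  unfolding collapse_def by (rule Least_le)

lemma collapse_le: "collapse U i \<le> i"
  by (rule collapse_least) simp

lemma collapse_mono:
  assumes "i \<le> i'"
  shows "collapse U i \<le> collapse U i'"
proof (cases "collapse U i' \<le> i")
  case True
  have "{collapse U i'..<i} \<subseteq> U"
    using collapse_subset[of U i'] assms by auto
  then show ?thesis
    by (rule collapse_least)
next
  case False
  then show ?thesis
    using collapse_le[of U i] by simp
qed

lemma collapse_eq_imp_subset: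
  assumes "collapse U i = collapse U i'"
  shows "{i..<i'} \<subseteq> U"
  using collapse_subset[of U i'] collapse_le[of U i] assms by auto

lemma collapse_Suc:
  assumes "i \<in> U"
  shows "collapse U (Suc i) = collapse U i"
proof (rule antisym)
  have "{collapse U i..<Suc i} \<subseteq> U"
    using collapse_subset[of U i] assms by (auto simp: less_Suc_eq)
  then show "collapse U (Suc i) \<le> collapse U i"
    by (rule collapse_least)
qed (simp add: collapse_mono)

lemma collapse_pos:
  assumes "0 \<notin> U" "0 < i"
  shows "0 < collapse U i"
  using collapse_subset[of U i] assms by (cases "collapse U i") auto

section \<open>Basic properties of semistandard tableaux\<close>

lemma semistandard_tableauxI:
  assumes "T \<in> D \<rightarrow>\<^sub>E {1..}"
    and "\<And>c c'. c \<in> D \<Longrightarrow> c' \<in> D \<Longrightarrow> fst c = fst c' \<Longrightarrow> snd c < snd c' \<Longrightarrow> T c \<le> T c'"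
    and "\<And>c c'. c \<in> D \<Longrightarrow> c' \<in> D \<Longrightarrow> snd c = snd c' \<Longrightarrow> fst c < fst c' \<Longrightarrow> T c < T c'"
  shows "T \<in> semistandard_tableaux D"
  using assms unfolding semistandard_tableaux_def by auto

lemma semistandard_tableaux_row:
  assumes "T \<in> semistandard_tableaux D" "c \<in> D" "c' \<in> D" "fst c = fst c'" "snd c \<le> snd c'"
  shows "T c \<le> T c'"
  using assms unfolding semistandard_tableaux_def
  by (cases c; cases c'; cases "snd c = snd c'") auto

lemma semistandard_tableaux_col:
  assumes "T \<in> semistandard_tableaux D" "c \<in> D" "c' \<in> D" "snd c = snd c'" "fst c < fst c'"
  shows "T c < T c'"
  using assms unfolding semistandard_tableaux_def by (cases c; cases c') auto

lemma semistandard_tableaux_PiE: "T \<in> semistandard_tableaux D \<Longrightarrow> T \<in> D \<rightarrow>\<^sub>E {1..}"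
  unfolding semistandard_tableaux_def by simp

lemma semistandard_tableaux_col_inj:
  assumes "T \<in> semistandard_tableaux D" "c \<in> D" "c' \<in> D" "snd c = snd c'" "T c = T c'"
  shows "c = c'"
  using semistandard_tableaux_col[OF assms(1,2,3)] semistandard_tableaux_col[OF assms(1,3,2)] assms(4,5)
  by (metis less_irrefl linorder_neqE_nat prod_eqI)

text \<open>Every letter from \<open>T c\<close> up to but excluding \<open>T c'\<close> belongs to
  \<open>U\<close> and occurs in the tableau, so the ascent conditions chain through actual cells. A
  letter without cells would make its condition vacuous and break the chain.\<close>

lemma same_collapse_imp_col_less:
  assumes U: "\<And>t. t \<in> U \<Longrightarrow> t \<in> T ` D" and asc: "U \<subseteq> ascents D T"
    and c: "c \<in> D" "c' \<in> D" "collapse U (T c) = collapse U (T c')" "T c < T c'"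
  shows "snd c < snd c'"
proof -
  have "{T c..<t} \<subseteq> U \<Longrightarrow> T c < t \<Longrightarrow> d \<in> D \<Longrightarrow> T d = t \<Longrightarrow> snd c < snd d" for t d
  proof (induction t arbitrary: d)
    case (Suc s)
    have sU: "s \<in> U"
      using Suc.prems by auto
    obtain e where e: "e \<in> D" "T e = s"
      using U[OF sU] by auto
    have *: "snd c' < snd d" if "c' \<in> D" "T c' = s" for c'
      using asc sU that Suc.prems unfolding ascents_def by blast
    show ?case
    proof (cases "T c = s")
      case True
      then show ?thesis
        using * c by simp
    next
      case False
      then have "snd c < snd e"
        using Suc.IH[OF _ _ e] Suc.prems(1,2) by (simp add: subset_iff)
      then show ?thesis
        using *[OF e] by simp
    qed
  qed simp
  then show ?thesis
    using c collapse_eq_imp_subset by blast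
qed

text \<open>The order behind standardization: a merged letter is split again from left to right.
  Cells tie only when entry and column agree, which semistandardness excludes.\<close>

lemma ex_sorted_cells:
  fixes T :: "cell \<Rightarrow> nat"
  assumes "finite D"
  obtains cs :: "cell list" where "set cs = D" "distinct cs"
    "sorted_wrt (\<lambda>c c'. c \<noteq> c' \<and> (T c < T c' \<or> T c = T c' \<and> snd c \<le> snd c')) cs"
proof -
  obtain xs where xs: "set xs = D" "distinct xs"
    using finite_distinct_list[OF assms] by blast
  define cs where "cs = sort_key (\<lambda>c. (T c, snd c)) xs"
  have "sorted (map (\<lambda>c. (T c, snd c)) cs)"
    unfolding cs_def by (rule sorted_sort_key)
  moreover have "distinct cs"
    by (simp add: cs_def xs)
  ultimately have "sorted_wrt (\<lambda>c c'. c \<noteq> c' \<and> (T c, snd c) \<le> (T c', snd c')) cs"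
    by (simp add: sorted_wrt_map sorted_wrt_iff_nth_less nth_eq_iff_index_eq)
  then have "sorted_wrt (\<lambda>c c'. c \<noteq> c' \<and> (T c < T c' \<or> T c = T c' \<and> snd c \<le> snd c')) cs"
    by (rule sorted_wrt_mono_rel[rotated]) (auto simp: less_eq_prod_def)
  with that[of cs] show ?thesis
    by (simp add: cs_def xs)
qed

lemma mset_map_enumeration:
  assumes "set cs = D" "distinct cs"
  shows "mset (map T cs) = image_mset T (mset_set D)"
  using assms mset_set_set by fastforce

text \<open>
  Standardization: with the cells in lexicographic order of (entry, column), the tableau with
  ascents in \<open>U\<close> that collapses to a given one is read off the sorted content.
\<close>

lemma card_tableaux_collapse:
  assumes fin: "finite D" and U: "\<And>t. t \<in> U \<Longrightarrow> t \<in># M \<and> Suc t \<in># M" and zero: "0 \<notin># M"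
  shows "card (tableaux_with_content D (image_mset (collapse U) M)) =
    card {T \<in> tableaux_with_content D M. U \<subseteq> ascents D T}"
proof -
  let ?A = "{T \<in> tableaux_with_content D M. U \<subseteq> ascents D T}"
  let ?B = "tableaux_with_content D (image_mset (collapse U) M)"
  let ?h = "\<lambda>T. restrict (collapse U \<circ> T) D"
  have U0: "0 \<notin> U"
    using U zero by blast
  have less: "snd c < snd c'"
    if "T \<in> ?A" "c \<in> D" "c' \<in> D" "collapse U (T c) = collapse U (T c')" "T c < T c'" for T c c'
  proof (rule same_collapse_imp_col_less[of U T D])
    have "set_mset M = T ` D"
      using that(1) fin unfolding tableaux_with_content_def by auto
    then show "t \<in> T ` D" if "t \<in> U" for t
      using U that by simp
  qed (use that in auto)
  \<comment> \<open>If \<open>collapse\<close> identified two entries of one column,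
    \<open>less\<close> would put them into different columns.\<close>
  have strict: "collapse U (T c) < collapse U (T c')"
    if T: "T \<in> ?A" and c: "c \<in> D" "c' \<in> D" "snd c = snd c'" "fst c < fst c'" for T c c'
  proof -
    have "T c < T c'"
      using T c semistandard_tableaux_col[of T D c c'] by (simp add: tableaux_with_content_def)
    then show ?thesis
      using less[OF T c(1,2)] c collapse_mono[of "T c" "T c'" U] by (auto simp: le_less)
  qed
  have h: "?h T \<in> ?B" if T: "T \<in> ?A" for T
  proof -
    have ss: "T \<in> semistandard_tableaux D" and M: "image_mset T (mset_set D) = M"
      using T by (auto simp: tableaux_with_content_def)
    have "?h T \<in> semistandard_tableaux D"
    proof (rule semistandard_tableauxI)
      show "?h T \<in> D \<rightarrow>\<^sub>E {1..}"
        using semistandard_tableaux_PiE[OF ss] collapse_pos[OF U0]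
        by (auto simp: PiE_iff Suc_le_eq)
    qed (use semistandard_tableaux_row[OF ss] strict[OF T] in \<open>auto intro!: collapse_mono\<close>)
    moreover have "image_mset (?h T) (mset_set D) = image_mset (collapse U) (image_mset T (mset_set D))"
      using fin by (auto simp: multiset.map_comp intro!: image_mset_cong)
    ultimately show ?thesis
      by (simp add: tableaux_with_content_def M)
  qed
  \<comment> \<open>The common image fixes the enumeration \<open>cs\<close>; along it both tableaux
    are the sorted list of the same multiset.\<close>
  have inj: "T1 = T2" if T: "T1 \<in> ?A" "T2 \<in> ?A" and eq: "?h T1 = ?h T2" for T1 T2
  proof -
    obtain cs where cs: "set cs = D" "distinct cs" and sorted:
      "sorted_wrt (\<lambda>c c'. c \<noteq> c' \<and> (?h T1 c < ?h T1 c' \<or> ?h T1 c = ?h T1 c' \<and> snd c \<le> snd c')) cs"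
      by (rule ex_sorted_cells[OF fin, of "?h T1"])
    have srt: "sorted (map T cs)" if T: "T \<in> ?A" "?h T = ?h T1" for T
      unfolding sorted_wrt_map
    proof (rule sorted_wrt_mono_rel[OF _ sorted])
      fix c c' assume c: "c \<in> set cs" "c' \<in> set cs"
        and "c \<noteq> c' \<and> (?h T1 c < ?h T1 c' \<or> ?h T1 c = ?h T1 c' \<and> snd c \<le> snd c')"
      then have *: "?h T c < ?h T c' \<or> ?h T c = ?h T c' \<and> snd c \<le> snd c'"
        by (simp add: T(2))
      show "T c \<le> T c'"
      proof (rule ccontr)
        assume "\<not> T c \<le> T c'"
        then show False
          using * less[OF T(1), of c' c] collapse_mono[of "T c'" "T c" U] c cs by auto
      qed
    qed
    have mset: "mset (map T cs) = M" if "T \<in> ?A" for T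
      unfolding mset_map_enumeration[OF cs] using that by (simp add: tableaux_with_content_def)
    have "mset (map T1 cs) = mset (map T2 cs)"
      unfolding mset[OF T(1)] mset[OF T(2)] ..
    moreover have "sorted (map T1 cs)" "sorted (map T2 cs)"
      using srt[OF T(1)] srt[OF T(2)] eq by simp_all
    ultimately have "map T1 cs = map T2 cs"
      using properties_for_sort[of "map T1 cs" "map T2 cs"] sorted_sort_id[of "map T2 cs"] by simp
    moreover have "T1 \<in> D \<rightarrow>\<^sub>E {1..}" "T2 \<in> D \<rightarrow>\<^sub>E {1..}"
      using T semistandard_tableaux_PiE by (auto simp: tableaux_with_content_def)
    ultimately show ?thesis
      using cs by (intro PiE_ext[of T1 D "\<lambda>_. {1..}" T2]) auto
  qed
  have surj: "\<exists>T'\<in>?A. ?h T' = T" if T: "T \<in> ?B" for T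
  proof -
    have ss: "T \<in> semistandard_tableaux D"
      and cont: "image_mset T (mset_set D) = image_mset (collapse U) M"
      using T by (auto simp: tableaux_with_content_def)
    obtain cs where cs: "set cs = D" "distinct cs" and sorted:
      "sorted_wrt (\<lambda>c c'. c \<noteq> c' \<and> (T c < T c' \<or> T c = T c' \<and> snd c \<le> snd c')) cs"
      by (rule ex_sorted_cells[OF fin, of T])
    define w where "w = sorted_list_of_multiset M"
    have w: "sorted w" "mset w = M"
      by (auto simp: w_def)
    have len: "length w = length cs"
      using arg_cong[OF cont, of size] arg_cong[OF w(2), of size] cs distinct_card[of cs] by simp
    \<comment> \<open>The preimage writes the sorted content \<open>w\<close> along the cells in
      \<open>cs\<close>.\<close>
    define T' where "T' = restrict (\<lambda>c. the (map_of (zip cs w) c)) D"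
    have nth: "T' (cs ! n) = w ! n" if "n < length cs" for n
      using that cs len nth_mem[OF that] by (simp add: T'_def map_of_zip_nth)
    have map: "map T' cs = w"
      using len by (intro nth_equalityI) (auto simp: nth)
    have "map T cs = map (collapse U) w"
    proof -
      have "sorted (map T cs)"
        unfolding sorted_wrt_map by (rule sorted_wrt_mono_rel[OF _ sorted]) auto
      moreover have "sorted (map (collapse U) w)"
        unfolding sorted_wrt_map by (rule sorted_wrt_mono_rel[OF _ w(1)]) (rule collapse_mono)
      moreover have "mset (map T cs) = mset (map (collapse U) w)"
        using cont w mset_map_enumeration[OF cs, of T] by simp
      ultimately show ?thesis
        using properties_for_sort[of "map T cs" "map (collapse U) w"] sorted_sort_id[of "map (collapse U) w"]
        by simp
    qed
    then have "map T cs = map (collapse U \<circ> T') cs"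
      unfolding map[symmetric] by simp
    then have hT: "collapse U (T' c) = T c" if "c \<in> D" for c
      using that cs(1) by simp
    have content: "image_mset T' (mset_set D) = M"
      using mset_map_enumeration[OF cs, of T'] map w by simp
    then have img: "T' ` D = set_mset M"
      using fin by auto
    have le: "T' c \<le> T' c'" if c: "c \<in> D" "c' \<in> D" and "T c < T c' \<or> T c = T c' \<and> snd c < snd c'" for c c'
    proof -
      obtain n n' where n: "c = cs ! n" "c' = cs ! n'" "n < length cs" "n' < length cs"
        using c cs by (auto simp: in_set_conv_nth)
      have "n \<le> n'"
      proof (rule ccontr)
        assume "\<not> n \<le> n'"
        then have "n' < n"
          by simp
        from sorted_wrt_nth_less[OF sorted this n(3)] show False
          using n(1,2) that(3) by auto
      qed
      then show ?thesis
        using n w(1) len by (simp add: nth sorted_nth_mono)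
    qed
    have "T' \<in> semistandard_tableaux D"
    proof (rule semistandard_tableauxI)
      have "T' c \<ge> 1" if "c \<in> D" for c
        using imageI[OF that, of T'] img zero by (cases "T' c") auto
      then show "T' \<in> D \<rightarrow>\<^sub>E {1..}"
        by (auto simp: T'_def)
    next
      fix c c' assume c: "c \<in> D" "c' \<in> D" "fst c = fst c'" "snd c < snd c'"
      then show "T' c \<le> T' c'"
        using le semistandard_tableaux_row[OF ss c(1,2,3)] by (auto simp: le_less)
    next
      fix c c' assume c: "c \<in> D" "c' \<in> D" "snd c = snd c'" "fst c < fst c'"
      then have "T c < T c'"
        using semistandard_tableaux_col[OF ss] by blast
      then show "T' c < T' c'"
        using collapse_mono[of "T' c'" "T' c" U] hT c by (metis not_le)
    qed
    \<comment> \<open>A cell with \<open>u\<close> not to the left of a cell with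
      \<open>Suc u\<close> would share its letter in \<open>T\<close>, hence lie strictly to the
      right of it and come later in \<open>cs\<close>, so its entry would be at least
      \<open>Suc u\<close>.\<close>
    moreover have "U \<subseteq> ascents D T'"
    proof
      fix u assume u: "u \<in> U"
      have "snd c < snd c'" if c: "c \<in> D" "c' \<in> D" "T' c = u" "T' c' = Suc u" for c c'
      proof (rule ccontr)
        assume "\<not> snd c < snd c'"
        moreover have Teq: "T c = T c'"
          using hT[of c] hT[of c'] collapse_Suc[OF u] c by simp
        moreover have "snd c \<noteq> snd c'"
          using semistandard_tableaux_col_inj[OF ss c(1,2)] Teq c by auto
        ultimately show False
          using le[of c' c] c by simp
      qed
      then show "u \<in> ascents D T'"
        by (auto simp: ascents_def)
    qed
    moreover have "?h T' = T"
      using hT semistandard_tableaux_PiE[OF ss] by (intro PiE_ext[of _ D "\<lambda>_. UNIV"]) (auto simp: PiE_iff)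
    ultimately show ?thesis
      using content by (auto simp: tableaux_with_content_def)
  qed
  have "bij_betw ?h ?A ?B"
    unfolding bij_betw_def using h inj surj by (auto simp: inj_on_def image_iff) metis
  then show ?thesis
    by (simp add: bij_betw_same_card)
qed

lemma finite_tableaux_with_content:
  assumes "finite D"
  shows "finite (tableaux_with_content D M)"
proof (rule finite_subset)
  show "tableaux_with_content D M \<subseteq> D \<rightarrow>\<^sub>E set_mset M"
    using assms semistandard_tableaux_PiE by (fastforce simp: tableaux_with_content_def)
  show "finite (D \<rightarrow>\<^sub>E set_mset M)"
    using assms by (simp add: finite_PiE)
qed

text \<open>
  For \<open>M = 1 + 2 + \<dots> + r + M'\<close> and \<open>W = {1..<r}\<close> this is the scalar product with \<open>e\<^sub>r h\<^bsub>\<mu>\<^esub>\<close>, where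
  \<open>\<mu>\<close> lists the multiplicities in \<open>M'\<close>, since \<open>e\<^sub>r\<close> is the alternating sum of the \<open>h\<^sub>c\<close> over the
  compositions \<open>c\<close> of \<open>r\<close>.
\<close>

definition descent_functional :: "nat multiset \<Rightarrow> nat set \<Rightarrow> power_series \<Rightarrow> real" where
  "descent_functional M W f =
     (\<Sum>U\<in>Pow W. (-1) ^ card U * f (monomial_of (image_mset (collapse U) M)))"

text \<open>Inclusion-exclusion: by standardization the term for \<open>U\<close> counts the
  tableaux whose ascents contain \<open>U\<close>, and the alternating sum keeps those with no
  ascent in \<open>W\<close>.\<close>

lemma descent_functional_tableau_series:
  assumes fin: "finite D" "finite W" and W: "\<And>t. t \<in> W \<Longrightarrow> t \<in># M \<and> Suc t \<in># M"
    and zero: "0 \<notin># M"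
  shows "descent_functional M W (tableau_series D) =
    real (card {T \<in> tableaux_with_content D M. W \<inter> ascents D T = {}})"
proof -
  let ?A = "tableaux_with_content D M"
  have finA: "finite ?A"
    by (rule finite_tableaux_with_content[OF fin(1)])
  have "descent_functional M W (tableau_series D) =
      (\<Sum>U\<in>Pow W. (-1) ^ card U * real (card {T \<in> ?A. U \<subseteq> ascents D T}))"
    unfolding descent_functional_def
  proof (rule sum.cong[OF refl])
    fix U assume "U \<in> Pow W"
    then have "t \<in># M \<and> Suc t \<in># M" if "t \<in> U" for t
      using W that by blast
    then show "(-1) ^ card U * tableau_series D (monomial_of (image_mset (collapse U) M)) =
        (-1) ^ card U * real (card {T \<in> ?A. U \<subseteq> ascents D T})"
      by (simp add: tableau_series_monomial_of[OF fin(1)] card_tableaux_collapse[OF fin(1) _ zero])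
  qed
  also have "\<dots> = (\<Sum>U\<in>Pow W. \<Sum>T\<in>?A. (-1) ^ card U * of_bool (U \<subseteq> ascents D T))"
    using finA by (simp add: Int_def flip: sum_distrib_left)
  also have "\<dots> = (\<Sum>T\<in>?A. \<Sum>U\<in>Pow W. (-1) ^ card U * of_bool (U \<subseteq> ascents D T))"
    by (rule sum.swap)
  also have "\<dots> = (\<Sum>T\<in>?A. of_bool (W \<inter> ascents D T = {}))"
  proof (rule sum.cong[OF refl])
    fix T
    have prod: "(\<Prod>t\<in>U. of_bool (t \<in> X)) = (of_bool (U \<subseteq> X) :: real)" if "finite U" for U X :: "nat set"
      using that by induction auto
    \<comment> \<open>For a single tableau the signed sum is the expansion of the product of
      \<open>1 - of_bool (t \<in> ascents D T)\<close> over \<open>W\<close>.\<close>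
    have "(\<Sum>U\<in>Pow W. (-1) ^ card U * of_bool (U \<subseteq> ascents D T)) =
        (\<Sum>U\<in>Pow W. (-1) ^ card U * (\<Prod>t\<in>U. of_bool (t \<in> ascents D T)) * (\<Prod>t\<in>W - U. (1::real)))"
      using fin(2) by (intro sum.cong) (auto simp: prod finite_subset)
    also have "\<dots> = (\<Prod>t\<in>W. 1 - of_bool (t \<in> ascents D T))"
      using fin(2) by (rule prod_diff_conv_sum[symmetric])
    also have "\<dots> = (\<Prod>t\<in>W. of_bool (t \<in> - ascents D T))"
      by (intro prod.cong) auto
    also have "\<dots> = of_bool (W \<inter> ascents D T = {})"
      using fin(2) by (subst prod) auto
    finally show "(\<Sum>U\<in>Pow W. (-1) ^ card U * of_bool (U \<subseteq> ascents D T)) =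
        (of_bool (W \<inter> ascents D T = {}) :: real)" .
  qed
  also have "\<dots> = real (card {T \<in> ?A. W \<inter> ascents D T = {}})"
    using finA by (simp add: Int_def)
  finally show ?thesis .
qed

section \<open>Nonnegativity on Schur-positive functions\<close>

lemma finite_young_diagram: "finite (young_diagram \<mu>)"
proof (rule finite_subset)
  show "young_diagram \<mu> \<subseteq> Sigma {..<length \<mu>} (\<lambda>i. {..<\<mu> ! i})"
    by (auto simp: young_diagram_def)
qed simp

lemma descent_functional_diff:
  "descent_functional M W (f - g) = descent_functional M W f - descent_functional M W g"
  by (simp add: descent_functional_def algebra_simps sum_subtractf)

text \<open>On each Schur function the functional is a number of tableaux, hence nonnegative;
  linearity does the rest.\<close>

lemma descent_functional_schur_positive:
  assumes "schur_positive f" and W: "finite W" "\<And>t. t \<in> W \<Longrightarrow> t \<in># M \<and> Suc t \<in># M"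
    and zero: "0 \<notin># M"
  shows "0 \<le> descent_functional M W f"
proof -
  obtain P c where P: "\<And>\<mu>. \<mu> \<in> P \<Longrightarrow> 0 \<le> c \<mu>" and f: "f = (\<lambda>m. \<Sum>\<mu>\<in>P. c \<mu> * schur \<mu> m)"
    using assms(1) unfolding schur_positive_def by blast
  have "descent_functional M W f = (\<Sum>\<mu>\<in>P. c \<mu> * descent_functional M W (schur \<mu>))"
    unfolding descent_functional_def f sum_distrib_left by (subst sum.swap) (simp add: mult_ac)
  also have "\<dots> \<ge> 0"
  proof (intro sum_nonneg mult_nonneg_nonneg P)
    show "0 \<le> descent_functional M W (schur \<mu>)" for \<mu>
      using descent_functional_tableau_series[OF finite_young_diagram W zero] by (simp add: schur_def)
  qed
  finally show ?thesis .
qed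

section \<open>Ribbon tableaux with prescribed descents\<close>

text \<open>The sum defining \<open>ribbon_start \<alpha> i\<close> contains the term of row
  \<open>i'\<close> and all terms of \<open>ribbon_start \<alpha> i'\<close>. So two rows share at
  most one column.\<close>

lemma ribbon_start_add_le:
  assumes "i < i'" "i' < length \<alpha>"
  shows "ribbon_start \<alpha> i' + \<alpha> ! i' \<le> Suc (ribbon_start \<alpha> i)"
proof -
  have "(\<Sum>k\<in>insert i' {Suc i'..<length \<alpha>}. \<alpha> ! k - 1) \<le> (\<Sum>k\<in>{Suc i..<length \<alpha>}. \<alpha> ! k - 1)"
    using assms by (intro sum_mono2) auto
  then show ?thesis
    by (simp add: ribbon_start_def)
qed

lemma ribbon_diagram_Sigma:
  "ribbon_diagram \<alpha> = Sigma {..<length \<alpha>} (\<lambda>i. {ribbon_start \<alpha> i..<ribbon_start \<alpha> i + \<alpha> ! i})"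
  by (auto simp: ribbon_diagram_def)

lemma finite_ribbon_diagram: "finite (ribbon_diagram \<alpha>)"
  by (simp add: ribbon_diagram_Sigma)

lemma card_ribbon_diagram: "card (ribbon_diagram \<alpha>) = sum_list \<alpha>"
  by (simp add: ribbon_diagram_Sigma sum_list_sum_nth atLeast0LessThan)

lemma up_closed_eq_atLeastLessThan:
  fixes S :: "nat set"
  assumes "S \<subseteq> {a..<b}" and "\<And>j j'. j \<in> S \<Longrightarrow> j \<le> j' \<Longrightarrow> j' < b \<Longrightarrow> j' \<in> S"
  shows "S = {b - card S..<b}"
proof (cases "S = {}")
  case False
  have fin: "finite S"
    using assms(1) finite_subset by blast
  have "S = {Min S..<b}"
  proof
    show "S \<subseteq> {Min S..<b}"
      using assms(1) fin by auto
    show "{Min S..<b} \<subseteq> S"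
      using assms(2)[of "Min S"] Min_in[OF fin False] by auto
  qed
  moreover have "Min S < b"
    using Min_in[OF fin False] assms(1) by auto
  ultimately show ?thesis
    by (metis card_atLeastLessThan diff_diff_cancel less_imp_le)
qed simp

text \<open>The size fixes the one multiplicity left out; this is used for the letter
  \<open>R\<close>.\<close>

lemma multiset_eq_if_counts_eq_except:
  assumes "size M = size M'" "\<And>v. v \<noteq> a \<Longrightarrow> count M v = count M' v"
  shows "M = M'"
proof -
  have split: "M = replicate_mset (count M a) a + filter_mset (\<lambda>v. v \<noteq> a) M" for M
    by (metis filter_eq_replicate_mset multiset_partition)
  have "filter_mset (\<lambda>v. v \<noteq> a) M = filter_mset (\<lambda>v. v \<noteq> a) M'"
    using assms(2) by (auto simp: multiset_eq_iff)
  moreover from this have "count M a = count M' a"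
    using arg_cong[OF split[of M], of size] arg_cong[OF split[of M'], of size] assms(1) by simp
  ultimately show ?thesis
    using split[of M] split[of M'] by metis
qed

text \<open>For \<open>R - 1 + k \<le> N\<close> the truncated subtraction is exact and the size is
  \<open>N\<close>, the number of cells of the ribbon.\<close>

definition ribbon_content :: "nat \<Rightarrow> nat \<Rightarrow> nat \<Rightarrow> nat multiset" where
  "ribbon_content R N k =
     mset_set {1..<R} + replicate_mset (N - (R - 1) - k) R + replicate_mset k (Suc R)"

lemma count_ribbon_content:
  "count (ribbon_content R N k) v =
    (if v \<in> {1..<R} then 1 else if v = R then N - (R - 1) - k else if v = Suc R then k else 0)"
  by (auto simp: ribbon_content_def)

lemma content_eq_ribbon_content_iff:
  assumes "finite D" "card D = N" "0 < R" "R - 1 + k \<le> N"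
  shows "image_mset T (mset_set D) = ribbon_content R N k \<longleftrightarrow>
    (\<forall>c\<in>D. T c \<in> {1..Suc R}) \<and> (\<forall>v\<in>{1..<R}. card {c \<in> D. T c = v} = 1) \<and>
    card {c \<in> D. T c = Suc R} = k" (is "?M = ?C \<longleftrightarrow> ?rhs")
proof
  assume eq: "?M = ?C"
  have cnt: "card {c \<in> D. T c = v} = count ?C v" for v
    using count_image_mset_set[OF assms(1), of T v] eq by simp
  have "T c \<in> {1..Suc R}" if "c \<in> D" for c
  proof -
    have "T c \<in># ?M"
      using that assms(1) by simp
    then have "0 < count ?C (T c)"
      using eq by simp
    then show ?thesis
      using assms(3) by (auto simp: count_ribbon_content split: if_splits)
  qed
  then show ?rhs
    by (simp add: cnt count_ribbon_content)
next
  assume rhs: ?rhs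
  show "?M = ?C"
  proof (rule multiset_eq_if_counts_eq_except)
    show "size ?M = size ?C"
      using assms by (simp add: ribbon_content_def)
    fix v assume "v \<noteq> R"
    moreover have "card {c \<in> D. T c = v} = 0" if "v \<notin> {1..Suc R}"
    proof -
      have "{c \<in> D. T c = v} = {}"
        using rhs that by auto
      then show ?thesis
        by (simp only: card.empty)
    qed
    ultimately show "count ?M v = count ?C v"
      unfolding count_image_mset_set[OF assms(1)] count_ribbon_content using rhs by auto
  qed
qed

text \<open>
  With \<open>R\<close> rows, the labels \<open>1..<R\<close> occupy the left ends of all rows but one, the row \<open>q\<close>; then \<open>x i\<close> is the
  number of entries \<open>Suc R\<close> in row \<open>i\<close>.
\<close>

definition row_choices :: "nat list \<Rightarrow> nat \<Rightarrow> nat \<Rightarrow> nat set" where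
  "row_choices \<alpha> q i =
     (if i = q \<and> Suc q = length \<alpha> then {..\<alpha> ! i}
      else if i = Suc q then {1..<\<alpha> ! i} else {..<\<alpha> ! i})"

text \<open>The label of row \<open>i\<close> is its rank, counted from 1, among the rows other than
  \<open>q\<close>: this is \<open>Suc i\<close> above row \<open>q\<close> and \<open>i\<close>
  below it.\<close>

definition ribbon_filling :: "nat list \<Rightarrow> nat \<Rightarrow> (nat \<Rightarrow> nat) \<Rightarrow> cell \<Rightarrow> nat" where
  "ribbon_filling \<alpha> q x = restrict
     (\<lambda>(i, j). if i \<noteq> q \<and> j = ribbon_start \<alpha> i then if i < q then Suc i else i
               else if j + x i < ribbon_start \<alpha> i + \<alpha> ! i then length \<alpha> else Suc (length \<alpha>))
     (ribbon_diagram \<alpha>)"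

definition ribbon_parameters :: "nat list \<Rightarrow> nat \<Rightarrow> (nat \<times> (nat \<Rightarrow> nat)) set" where
  "ribbon_parameters \<alpha> k = Sigma {..<length \<alpha>} (\<lambda>q.
     {x \<in> PiE {..<length \<alpha>} (row_choices \<alpha> q). (\<Sum>i<length \<alpha>. x i) = k})"

text \<open>Each label has to lie weakly to the left of the previous one, which in a ribbon tableau
  means in a lower row. The range stops before \<open>length \<alpha> - 1\<close>, so the last label
  is not compared with the letter \<open>length \<alpha>\<close>.\<close>

definition ribbon_descent_tableaux :: "nat list \<Rightarrow> nat \<Rightarrow> (cell \<Rightarrow> nat) set" where
  "ribbon_descent_tableaux \<alpha> k =
     {T \<in> tableaux_with_content (ribbon_diagram \<alpha>) (ribbon_content (length \<alpha>) (sum_list \<alpha>) k).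
        {1..<length \<alpha> - 1} \<inter> ascents (ribbon_diagram \<alpha>) T = {}}"

section \<open>Bijection between descent tableaux and parameters\<close>

context
  fixes \<alpha> :: "nat list" and R :: nat and s :: "nat \<Rightarrow> nat" and D :: "cell set"
  assumes pos: "\<And>i. i < length \<alpha> \<Longrightarrow> 0 < \<alpha> ! i"
  defines "R \<equiv> length \<alpha>" and "s \<equiv> ribbon_start \<alpha>" and "D \<equiv> ribbon_diagram \<alpha>"
begin

lemma in_ribbon_iff: "(i, j) \<in> D \<longleftrightarrow> i < R \<and> s i \<le> j \<and> j < s i + \<alpha> ! i"
  by (simp add: D_def ribbon_diagram_def R_def s_def)

lemma start_in_ribbon: "i < R \<Longrightarrow> (i, s i) \<in> D"
  using pos by (simp add: in_ribbon_iff R_def)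

lemma start_add_le: "i < i' \<Longrightarrow> i' < R \<Longrightarrow> s i' + \<alpha> ! i' \<le> Suc (s i)"
  unfolding R_def s_def by (rule ribbon_start_add_le)

text \<open>Overlapping rows share one column only. They need not be adjacent, since rows of length
  1 make longer columns.\<close>

lemma same_column:
  assumes "(i, j) \<in> D" "(i', j) \<in> D" "i < i'"
  shows "j = s i" "Suc j = s i' + \<alpha> ! i'"
  using assms start_add_le[of i i'] by (auto simp: in_ribbon_iff)

lemma filling_eq:
  assumes "(i, j) \<in> D"
  shows "ribbon_filling \<alpha> q x (i, j) = (if i \<noteq> q \<and> j = s i then if i < q then Suc i else i
    else if j + x i < s i + \<alpha> ! i then R else Suc R)"
  using assms by (simp add: ribbon_filling_def D_def R_def s_def)

text \<open>A labelled row keeps its left end, so \<open>x i < \<alpha> ! i\<close> there. If row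
  \<open>q\<close> is not the last, its left end lies over the right end of row
  \<open>Suc q\<close>, and strictness forces \<open>R\<close> over \<open>Suc R\<close>: hence
  \<open>x q < \<alpha> ! q\<close> and \<open>0 < x (Suc q)\<close>.\<close>

lemma row_choices_bounds:
  assumes "x \<in> PiE {..<R} (row_choices \<alpha> q)" "i < R"
  shows "x i \<le> \<alpha> ! i" "i \<noteq> q \<or> Suc q < R \<Longrightarrow> x i < \<alpha> ! i" "i = Suc q \<Longrightarrow> 0 < x i"
  using PiE_mem[OF assms(1), of i] assms(2) by (auto simp: row_choices_def R_def split: if_splits)

lemma filling_last_iff:
  assumes x: "x \<in> PiE {..<R} (row_choices \<alpha> q)" and ij: "(i, j) \<in> D" and q: "q < R"
  shows "ribbon_filling \<alpha> q x (i, j) = Suc R \<longleftrightarrow> s i + \<alpha> ! i \<le> j + x i"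
proof (cases "i \<noteq> q \<and> j = s i")
  case True
  then show ?thesis
    using row_choices_bounds(2)[OF x, of i] ij q by (simp add: filling_eq in_ribbon_iff)
next
  case False
  then show ?thesis
    using ij by (auto simp: filling_eq)
qed

lemma filling_last_entries:
  assumes "x \<in> PiE {..<R} (row_choices \<alpha> q)" "i < R" "q < R"
  shows "{j \<in> {s i..<s i + \<alpha> ! i}. ribbon_filling \<alpha> q x (i, j) = Suc R} = {s i + \<alpha> ! i - x i..<s i + \<alpha> ! i}"
  using row_choices_bounds(1)[OF assms(1,2)] assms(2)
  by (auto simp: filling_last_iff[OF assms(1) _ assms(3)] in_ribbon_iff)

lemma filling_in_descent_tableaux:
  assumes k: "R - 1 + k \<le> sum_list \<alpha>" and qx: "(q, x) \<in> ribbon_parameters \<alpha> k"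
  shows "ribbon_filling \<alpha> q x \<in> ribbon_descent_tableaux \<alpha> k"
proof -
  let ?T = "ribbon_filling \<alpha> q x"
  have q: "q < R" and x: "x \<in> PiE {..<R} (row_choices \<alpha> q)" and sum: "(\<Sum>i<R. x i) = k"
    using qx by (auto simp: ribbon_parameters_def R_def)
  note bounds = row_choices_bounds[OF x]
  have range: "?T c \<in> {1..Suc R}" if "c \<in> D" for c
    using that q by (cases c) (auto simp: filling_eq in_ribbon_iff)
  have ss: "?T \<in> semistandard_tableaux D"
  proof (rule semistandard_tableauxI)
    show "?T \<in> D \<rightarrow>\<^sub>E {1..}"
      using range by (auto simp: ribbon_filling_def D_def)
  next
    fix c c' assume "c \<in> D" "c' \<in> D" "fst c = fst c'" "snd c < snd c'"
    then show "?T c \<le> ?T c'"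
      using q by (cases c; cases c') (auto simp: filling_eq in_ribbon_iff)
  next
    fix c c' assume c: "c \<in> D" "c' \<in> D" "snd c = snd c'" "fst c < fst c'"
    then obtain i i' j where ij: "c = (i, j)" "c' = (i', j)" "i < i'" "(i, j) \<in> D" "(i', j) \<in> D"
      by (cases c; cases c') auto
    note j = same_column[OF ij(4,5,3)]
    have i': "i' < R"
      using ij by (simp add: in_ribbon_iff)
    show "?T c < ?T c'"
    proof (cases "i = q")
      case False
      then show ?thesis
        using ij i' j by (auto simp: filling_eq)
    next
      case True
      have Sq: "Suc q < R" "Suc q \<le> i'"
        using True ij(3) i' by auto
      have b: "x q < \<alpha> ! q" "0 < x (Suc q)" "x (Suc q) < \<alpha> ! Suc q"
        using bounds(2)[of q] bounds(2,3)[of "Suc q"] Sq(1) by auto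
      \<comment> \<open>Row \<open>Suc q\<close> holds a label and at least one
        \<open>Suc R\<close>, so it has two or more cells and no lower row reaches this
        column.\<close>
      have "i' = Suc q"
      proof (rule ccontr)
        assume "i' \<noteq> Suc q"
        then have "Suc q < i'"
          using Sq by simp
        then show False
          using start_add_le[of "Suc q" i'] start_add_le[of q "Suc q"] i' Sq j b True by simp
      qed
      then show ?thesis
        using ij j b True by (simp add: filling_eq)
    qed
  qed
  have label: "{c \<in> D. ?T c = v} = {(if v \<le> q then v - 1 else v, s (if v \<le> q then v - 1 else v))}"
    if v: "v \<in> {1..<R}" for v
  proof -
    let ?i = "if v \<le> q then v - 1 else v"
    have i: "?i < R" "?i \<noteq> q"
      using v by auto
    have "?T (?i, s ?i) = v"
      using v i by (subst filling_eq[OF start_in_ribbon]) auto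
    moreover have "c = (?i, s ?i)" if "c \<in> D" "?T c = v" for c
      using that v by (cases c) (auto simp: filling_eq split: if_splits)
    ultimately show ?thesis
      using start_in_ribbon[OF i(1)] by blast
  qed
  have "{c \<in> D. ?T c = Suc R} = Sigma {..<R} (\<lambda>i. {j \<in> {s i..<s i + \<alpha> ! i}. ?T (i, j) = Suc R})"
    by (auto simp: in_ribbon_iff)
  also have "\<dots> = Sigma {..<R} (\<lambda>i. {s i + \<alpha> ! i - x i..<s i + \<alpha> ! i})"
    by (rule Sigma_cong[OF refl]) (use filling_last_entries[OF x _ q] in simp)
  also have "card \<dots> = (\<Sum>i<R. x i)"
    using bounds(1) by (simp add: le_diff_conv2 trans_le_add2)
  finally have last: "card {c \<in> D. ?T c = Suc R} = k"
    using sum by simp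
  have "t \<notin> ascents D ?T" if t: "t \<in> {1..<R - 1}" for t
  proof -
    define p where "p v = (if v \<le> q then v - 1 else v)" for v
    have tR: "t \<in> {1..<R}" "Suc t \<in> {1..<R}"
      using t by auto
    have c: "(p t, s (p t)) \<in> {c \<in> D. ?T c = t}" "(p (Suc t), s (p (Suc t))) \<in> {c \<in> D. ?T c = Suc t}"
      unfolding label[OF tR(1)] label[OF tR(2)] by (auto simp: p_def)
    have "p t < p (Suc t)" "p (Suc t) < R"
      using t by (auto simp: p_def)
    then have "\<not> s (p t) < s (p (Suc t))"
      using start_add_le[of "p t" "p (Suc t)"] pos[of "p (Suc t)"] by (simp add: R_def)
    then show ?thesis
      using c by (fastforce simp: ascents_def)
  qed
  moreover have "image_mset ?T (mset_set D) = ribbon_content R (sum_list \<alpha>) k"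
  proof (subst content_eq_ribbon_content_iff)
    show "(\<forall>c\<in>D. ?T c \<in> {1..Suc R}) \<and> (\<forall>v\<in>{1..<R}. card {c \<in> D. ?T c = v} = 1) \<and>
        card {c \<in> D. ?T c = Suc R} = k"
      using range label last by simp
  qed (use k q in \<open>simp_all add: D_def finite_ribbon_diagram card_ribbon_diagram\<close>)
  ultimately show ?thesis
    using ss unfolding ribbon_descent_tableaux_def tableaux_with_content_def
    by (auto simp: D_def R_def)
qed

text \<open>The tableau shows \<open>q\<close> as the row whose left end carries no label, and
  \<open>x i\<close> as the number of entries \<open>Suc R\<close> in row \<open>i\<close>.\<close>

lemma inj_on_filling:
  "inj_on (\<lambda>(q, x). ribbon_filling \<alpha> q x) (ribbon_parameters \<alpha> k)"
proof (rule inj_onI, clarify)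
  fix q x q' x'
  assume qx: "(q, x) \<in> ribbon_parameters \<alpha> k" "(q', x') \<in> ribbon_parameters \<alpha> k"
    and eq: "ribbon_filling \<alpha> q x = ribbon_filling \<alpha> q' x'"
  have q: "q < R" "q' < R" and x: "x \<in> PiE {..<R} (row_choices \<alpha> q)" "x' \<in> PiE {..<R} (row_choices \<alpha> q')"
    using qx by (auto simp: ribbon_parameters_def R_def)
  have qq: "q = q'"
  proof (rule ccontr)
    assume "q \<noteq> q'"
    then show False
      using fun_cong[OF eq, of "(q', s q')"] q start_in_ribbon[OF q(2)]
      by (auto simp: filling_eq split: if_splits)
  qed
  moreover have "x = x'"
  proof (rule PiE_ext[OF x(1)])
    show "x' \<in> PiE {..<R} (row_choices \<alpha> q)"
      using x qq by simp
    fix i assume "i \<in> {..<R}"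
    then have i: "i < R"
      by simp
    have "{s i + \<alpha> ! i - x i..<s i + \<alpha> ! i} = {s i + \<alpha> ! i - x' i..<s i + \<alpha> ! i}"
      using filling_last_entries[OF x(1) i q(1)] filling_last_entries[OF x(2) i q(2)] eq by simp
    from arg_cong[OF this, of card] show "x i = x' i"
      using row_choices_bounds(1)[OF x(1) i] row_choices_bounds(1)[OF x(2) i] by simp
  qed
  ultimately show "q = q' \<and> x = x'"
    by simp
qed

lemma descent_tableau_is_filling:
  assumes R: "0 < R" and k: "R - 1 + k \<le> sum_list \<alpha>" and T: "T \<in> ribbon_descent_tableaux \<alpha> k"
  shows "\<exists>q x. (q, x) \<in> ribbon_parameters \<alpha> k \<and> ribbon_filling \<alpha> q x = T"
proof -
  have ss: "T \<in> semistandard_tableaux D" and desc: "{1..<R - 1} \<inter> ascents D T = {}"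
    and cont: "image_mset T (mset_set D) = ribbon_content R (sum_list \<alpha>) k"
    using T by (auto simp: ribbon_descent_tableaux_def tableaux_with_content_def D_def R_def)
  have range: "\<And>c. c \<in> D \<Longrightarrow> T c \<in> {1..Suc R}"
    and lab: "\<And>v. v \<in> {1..<R} \<Longrightarrow> card {c \<in> D. T c = v} = 1"
    and last: "card {c \<in> D. T c = Suc R} = k"
    using content_eq_ribbon_content_iff[of D "sum_list \<alpha>" R k T] cont R k
    by (simp_all add: D_def finite_ribbon_diagram card_ribbon_diagram)
  have "\<exists>c. {c \<in> D. T c = v} = {c}" if "v \<in> {1..<R}" for v
    using lab[OF that] by (simp add: card_1_singleton_iff)
  then obtain cl where cl: "\<And>v. v \<in> {1..<R} \<Longrightarrow> {c \<in> D. T c = v} = {cl v}"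
    by metis
  have cl_in: "cl v \<in> D" "T (cl v) = v" if "v \<in> {1..<R}" for v
    using cl[OF that] by auto
  have cl_unique: "c = cl (T c)" if "c \<in> D" "T c < R" for c
    using cl[of "T c"] range[of c] that by auto
  define \<rho> where "\<rho> v = fst (cl v)" for v
  have \<rho>_less: "\<rho> v < R" if "v \<in> {1..<R}" for v
    using cl_in(1)[OF that] unfolding \<rho>_def by (cases "cl v") (simp add: in_ribbon_iff)
  \<comment> \<open>As \<open>t\<close> is no ascent, \<open>Suc t\<close> lies weakly to the left
    of \<open>t\<close>. In the same row this contradicts weak increase; in a higher row it forces a
    common column with the larger entry on top.\<close>
  have step: "\<rho> t < \<rho> (Suc t)" if t: "t \<in> {1..<R}" "Suc t \<in> {1..<R}" for t
  proof -
    have "t \<in> {1..<R - 1}"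
      using t by (simp add: less_diff_conv)
    then have "t \<notin> ascents D T"
      using desc by blast
    then obtain c c' where c: "c \<in> D" "c' \<in> D" "T c = t" "T c' = Suc t" "snd c' \<le> snd c"
      by (auto simp: ascents_def not_less)
    then have c_eq: "c = cl t" "c' = cl (Suc t)"
      using cl_unique[of c] cl_unique[of c'] t by auto
    have "fst c < fst c'"
    proof (rule ccontr)
      assume "\<not> fst c < fst c'"
      then consider "fst c = fst c'" | "fst c' < fst c"
        by linarith
      then show False
      proof cases
        case 1
        then show False
          using semistandard_tableaux_row[OF ss c(2,1)] c by simp
      next
        case 2
        then have "snd c = snd c'"
          using c start_add_le[of "fst c'" "fst c"] by (cases c; cases c') (auto simp: in_ribbon_iff)
        then show False
          using semistandard_tableaux_col[OF ss c(2,1)] 2 c by simp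
      qed
    qed
    then show ?thesis
      by (simp add: \<rho>_def c_eq)
  qed
  have \<rho>_mono: "\<rho> u < \<rho> v" if "u < v" "u \<in> {1..<R}" "v \<in> {1..<R}" for u v
    using that
  proof (induction v)
    case (Suc v)
    then show ?case
      using step[of v] by (cases "u = v") (auto intro: less_trans)
  qed simp
  have \<rho>_inj: "inj_on \<rho> {1..<R}"
    using \<rho>_mono by (intro linorder_inj_onI) fastforce+
  \<comment> \<open>The \<open>R - 1\<close> labels occupy distinct rows, so exactly one row
    \<open>q\<close> stays free.\<close>
  have "card ({..<R} - \<rho> ` {1..<R}) = card {..<R} - card (\<rho> ` {1..<R})"
    using \<rho>_less by (intro card_Diff_subset) auto
  also have "\<dots> = R - (R - 1)"
    by (simp only: card_image[OF \<rho>_inj] card_lessThan card_atLeastLessThan)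
  also have "\<dots> = 1"
    using R by simp
  finally have "card ({..<R} - \<rho> ` {1..<R}) = 1" .
  then obtain q where q: "{..<R} - \<rho> ` {1..<R} = {q}"
    by (auto simp: card_1_singleton_iff)
  have qR: "q < R"
    using q by blast
  have \<rho>_surj: "\<exists>v\<in>{1..<R}. \<rho> v = i" if "i < R" "i \<noteq> q" for i
    using q that by blast
  have \<rho>_q: "\<rho> v \<noteq> q" if "v \<in> {1..<R}" for v
    using q that by blast
  \<comment> \<open>Otherwise the left end of the row would carry a smaller label, against
    \<open>\<rho>_mono\<close>.\<close>
  have start: "snd (cl v) = s (\<rho> v)" if v: "v \<in> {1..<R}" for v
  proof (rule ccontr)
    assume ne: "snd (cl v) \<noteq> s (\<rho> v)"
    define u where "u = T (\<rho> v, s (\<rho> v))"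
    have c0: "(\<rho> v, s (\<rho> v)) \<in> D"
      by (rule start_in_ribbon[OF \<rho>_less[OF v]])
    have "s (\<rho> v) \<le> snd (cl v)"
      using cl_in(1)[OF v] unfolding \<rho>_def by (cases "cl v") (simp add: in_ribbon_iff)
    then have "u \<le> v"
      using semistandard_tableaux_row[OF ss c0 cl_in(1)[OF v]] cl_in(2)[OF v] by (simp add: u_def \<rho>_def)
    then have u: "u \<in> {1..<R}"
      using range[OF c0] v by (simp add: u_def)
    have cu: "cl u = (\<rho> v, s (\<rho> v))"
      using cl_unique[OF c0] u by (simp add: u_def)
    then have "u \<noteq> v"
      using ne by auto
    then have "\<rho> u < \<rho> v"
      using \<rho>_mono u v \<open>u \<le> v\<close> by simp
    then show False
      using cu by (simp add: \<rho>_def)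
  qed
  \<comment> \<open>The labels \<open>1..v\<close> occupy exactly the rows down to
    \<open>\<rho> v\<close> other than \<open>q\<close>; counting these rows gives
    \<open>v\<close>.\<close>
  have rank: "v = (if \<rho> v < q then Suc (\<rho> v) else \<rho> v)" if v: "v \<in> {1..<R}" for v
  proof -
    have "\<rho> ` {1..v} = {..\<rho> v} - {q}"
    proof (intro equalityI subsetI)
      fix i assume "i \<in> \<rho> ` {1..v}"
      then obtain u where u: "u \<in> {1..<R}" "u \<le> v" "i = \<rho> u"
        using v by auto
      then show "i \<in> {..\<rho> v} - {q}"
        using \<rho>_mono[of u v] \<rho>_q[of u] v by (cases "u = v") auto
    next
      fix i assume i: "i \<in> {..\<rho> v} - {q}"
      then obtain u where u: "u \<in> {1..<R}" "\<rho> u = i"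
        using \<rho>_surj[of i] \<rho>_less[OF v] by auto
      then show "i \<in> \<rho> ` {1..v}"
        using \<rho>_mono[of v u] v i by (cases "u \<le> v") auto
    qed
    moreover have "inj_on \<rho> {1..v}"
      by (rule inj_on_subset[OF \<rho>_inj]) (use v in auto)
    then have "card (\<rho> ` {1..v}) = v"
      by (simp add: card_image)
    ultimately show ?thesis
      using \<rho>_q[OF v] by (auto simp: card_Diff_singleton_if not_less)
  qed
  have first: "T (i, s i) = (if i < q then Suc i else i)" if i: "i < R" "i \<noteq> q" for i
  proof -
    obtain v where v: "v \<in> {1..<R}" "\<rho> v = i"
      using \<rho>_surj[OF i] by blast
    then have "cl v = (i, s i)"
      using start[OF v(1)] by (auto simp: \<rho>_def prod_eq_iff)
    then have "T (i, s i) = v"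
      using cl_in(2)[OF v(1)] by simp
    also have "v = (if i < q then Suc i else i)"
      using rank[OF v(1)] unfolding v(2) .
    finally show ?thesis .
  qed
  have other: "T (i, j) \<in> {R, Suc R}" if ij: "(i, j) \<in> D" "\<not> (i \<noteq> q \<and> j = s i)" for i j
  proof (rule ccontr)
    assume "T (i, j) \<notin> {R, Suc R}"
    then have v: "T (i, j) \<in> {1..<R}"
      using range[OF ij(1)] by auto
    have cl_ij: "(i, j) = cl (T (i, j))"
      using cl_unique[OF ij(1)] v by simp
    then show False
      using start[OF v] \<rho>_q[OF v] ij(2) unfolding \<rho>_def by (metis fst_conv snd_conv)
  qed
  define B where "B i = {j \<in> {s i..<s i + \<alpha> ! i}. T (i, j) = Suc R}" for i
  define x where "x = restrict (\<lambda>i. card (B i)) {..<R}"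
  have B: "B i = {s i + \<alpha> ! i - x i..<s i + \<alpha> ! i}" if i: "i < R" for i
  proof -
    have "B i = {s i + \<alpha> ! i - card (B i)..<s i + \<alpha> ! i}"
    proof (rule up_closed_eq_atLeastLessThan)
      show "B i \<subseteq> {s i..<s i + \<alpha> ! i}"
        by (auto simp: B_def)
      fix j j' assume j: "j \<in> B i" "j \<le> j'" "j' < s i + \<alpha> ! i"
      then have c: "(i, j) \<in> D" "(i, j') \<in> D"
        using i by (auto simp: in_ribbon_iff B_def)
      then have "T (i, j) \<le> T (i, j')"
        using semistandard_tableaux_row[OF ss c] j by simp
      then show "j' \<in> B i"
        using range[OF c(2)] j by (auto simp: B_def)
    qed
    then show ?thesis
      using i by (simp add: x_def)
  qed
  have xle: "x i \<le> \<alpha> ! i" if "i < R" for i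
  proof -
    have "card (B i) \<le> card {s i..<s i + \<alpha> ! i}"
      by (rule card_mono) (auto simp: B_def)
    then show ?thesis
      using that by (simp add: x_def)
  qed
  have last_iff: "T (i, j) = Suc R \<longleftrightarrow> s i + \<alpha> ! i \<le> j + x i" if "(i, j) \<in> D" for i j
  proof -
    have "j \<in> B i \<longleftrightarrow> s i + \<alpha> ! i \<le> j + x i"
      using B[of i] that by (auto simp: in_ribbon_iff)
    then show ?thesis
      using that by (auto simp: B_def in_ribbon_iff)
  qed
  have "x \<in> PiE {..<R} (row_choices \<alpha> q)"
  proof (rule PiE_I)
    fix i assume "i \<in> {..<R}"
    then have i: "i < R"
      by simp
    have lt: "x i < \<alpha> ! i" if "T (i, s i) \<noteq> Suc R"
      using last_iff[OF start_in_ribbon[OF i]] that by simp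
    show "x i \<in> row_choices \<alpha> q i"
    proof (cases "i = q \<and> Suc q = R")
      case True
      then show ?thesis
        using xle[OF i] by (simp add: row_choices_def R_def)
    next
      case False
      \<comment> \<open>The upper entry is \<open>R\<close> or \<open>Suc R\<close> and has a larger
        entry below it, which can only be \<open>Suc R\<close>.\<close>
      have up: "T (q, s q) = R \<and> T (Suc q, s (Suc q) + \<alpha> ! Suc q - 1) = Suc R \<and>
          (Suc q, s (Suc q) + \<alpha> ! Suc q - 1) \<in> D" if "Suc q < R"
      proof -
        have c: "(q, s q) \<in> D" "(Suc q, s (Suc q) + \<alpha> ! Suc q - 1) \<in> D"
          using that pos[of "Suc q"] start_in_ribbon[OF qR] by (auto simp: in_ribbon_iff R_def)
        have "s q = s (Suc q) + \<alpha> ! Suc q - 1"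
          using ribbon_rows_overlap[of q \<alpha>] that pos[of "Suc q"] by (simp add: s_def R_def)
        then have "T (q, s q) < T (Suc q, s (Suc q) + \<alpha> ! Suc q - 1)"
          using semistandard_tableaux_col[OF ss c] by simp
        then show ?thesis
          using other[OF c(1)] range[OF c(2)] c by auto
      qed
      have "x i < \<alpha> ! i"
      proof (cases "i = q")
        case True
        then have "Suc q < R"
          using False qR by simp
        then show ?thesis
          using lt up True by simp
      next
        case False
        then show ?thesis
          using lt first[OF i] i qR by simp
      qed
      moreover have "0 < x i" if "i = Suc q"
        using up last_iff[of i "s i + \<alpha> ! i - 1"] that i pos[of i] by (auto simp: R_def)
      ultimately show ?thesis
        using False by (auto simp: row_choices_def R_def)
    qed
  qed (simp add: x_def)
  moreover have "(\<Sum>i<R. x i) = k"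
  proof -
    have "{c \<in> D. T c = Suc R} = Sigma {..<R} B"
      by (auto simp: in_ribbon_iff B_def)
    moreover have "card (Sigma {..<R} B) = (\<Sum>i<R. card (B i))"
      by (rule card_SigmaI) (auto simp: B_def)
    ultimately show ?thesis
      using last by (simp add: x_def)
  qed
  moreover have "ribbon_filling \<alpha> q x = T"
  proof (rule PiE_ext)
    show "T \<in> D \<rightarrow>\<^sub>E UNIV" "ribbon_filling \<alpha> q x \<in> D \<rightarrow>\<^sub>E UNIV"
      using semistandard_tableaux_PiE[OF ss] by (auto simp: PiE_iff ribbon_filling_def D_def)
    fix c assume c: "c \<in> D"
    then show "ribbon_filling \<alpha> q x c = T c"
      using first other last_iff by (cases c) (fastforce simp: filling_eq in_ribbon_iff)
  qed
  ultimately show ?thesis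
    using qR by (auto simp: ribbon_parameters_def R_def)
qed

lemma card_ribbon_descent_tableaux:
  assumes "0 < R" "R - 1 + k \<le> sum_list \<alpha>"
  shows "card (ribbon_descent_tableaux \<alpha> k) = card (ribbon_parameters \<alpha> k)"
proof -
  have "bij_betw (\<lambda>(q, x). ribbon_filling \<alpha> q x) (ribbon_parameters \<alpha> k) (ribbon_descent_tableaux \<alpha> k)"
    unfolding bij_betw_def
  proof (intro conjI inj_on_filling equalityI subsetI)
    fix T assume "T \<in> ribbon_descent_tableaux \<alpha> k"
    then obtain q x where "(q, x) \<in> ribbon_parameters \<alpha> k" "ribbon_filling \<alpha> q x = T"
      using descent_tableau_is_filling[OF assms] by blast
    then show "T \<in> (\<lambda>(q, x). ribbon_filling \<alpha> q x) ` ribbon_parameters \<alpha> k"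
      by force
  qed (use filling_in_descent_tableaux[OF assms(2)] in auto)
  then show ?thesis
    by (simp add: bij_betw_same_card)
qed

end

section \<open>Generating function of the parameters\<close>

text \<open>The polynomial \<open>[n]\<close>; integer coefficients allow the subtractions
  below.\<close>

definition geometric_poly :: "nat \<Rightarrow> int poly" where
  "geometric_poly n = (\<Sum>i<n. monom 1 i)"

lemma geometric_poly_eq: "(1 - monom 1 1) * geometric_poly n = 1 - monom 1 n"
proof (induction n)
  case (Suc n)
  have "(1 - monom 1 1) * geometric_poly (Suc n) =
      (1 - monom 1 1) * geometric_poly n + (1 - monom 1 1) * monom 1 n"
    by (simp add: geometric_poly_def distrib_left)
  also have "\<dots> = 1 - monom 1 (Suc n)"
    unfolding Suc.IH by (simp add: left_diff_distrib mult_monom)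
  finally show ?case .
qed (simp add: geometric_poly_def)

lemma coeff_geometric_poly_0: "coeff (geometric_poly n) 0 = (if n = 0 then 0 else 1)"
  by (cases n) (simp_all add: geometric_poly_def coeff_sum sum.delta)

lemma sum_monom_row_choices:
  assumes "i < length \<alpha>" "0 < \<alpha> ! i"
  shows "(\<Sum>b\<in>row_choices \<alpha> q i. monom 1 b :: int poly) =
    (if i = q \<and> Suc q = length \<alpha> then geometric_poly (\<alpha> ! i) + monom 1 (\<alpha> ! i)
     else if i = Suc q then geometric_poly (\<alpha> ! i) - 1 else geometric_poly (\<alpha> ! i))"
proof -
  have "{..<\<alpha> ! i} = insert 0 {1..<\<alpha> ! i}"
    using assms(2) by auto
  then have "(\<Sum>b\<in>{1..<\<alpha> ! i}. monom 1 b :: int poly) = geometric_poly (\<alpha> ! i) - 1"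
    by (simp add: geometric_poly_def)
  moreover have "(\<Sum>b\<le>\<alpha> ! i. monom 1 b :: int poly) = geometric_poly (\<alpha> ! i) + monom 1 (\<alpha> ! i)"
    by (simp add: geometric_poly_def flip: lessThan_Suc_atMost)
  ultimately show ?thesis
    by (auto simp: row_choices_def geometric_poly_def[symmetric])
qed

text \<open>Expanding the product gives one monomial per choice function, with the sum of its values
  as exponent.\<close>

lemma card_PiE_sum_eq:
  assumes "finite I" "\<And>i. i \<in> I \<Longrightarrow> finite (B i)"
  shows "int (card {x \<in> PiE I B. (\<Sum>i\<in>I. x i) = k}) = coeff (\<Prod>i\<in>I. \<Sum>b\<in>B i. monom 1 b) k"
proof -
  have "(\<Prod>i\<in>I. monom 1 (x i)) = (monom 1 (\<Sum>i\<in>I. x i) :: int poly)" for x :: "'a \<Rightarrow> nat"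
    using assms(1) by induction (simp_all add: mult_monom)
  then have "(\<Prod>i\<in>I. \<Sum>b\<in>B i. monom 1 b) = (\<Sum>x\<in>PiE I B. monom 1 (\<Sum>i\<in>I. x i) :: int poly)"
    by (simp add: prod_sum_PiE[OF assms])
  moreover have "finite (PiE I B)"
    using assms by (rule finite_PiE)
  ultimately show ?thesis
    by (simp add: coeff_sum Int_def flip: of_bool_def)
qed

text \<open>The quotient \<open>P / [a]\<close> for a part \<open>a\<close>, formed without
  division. It depends only on \<open>a\<close> and the multiset of parts, which both compositions
  share.\<close>

definition cofactor :: "nat multiset \<Rightarrow> nat \<Rightarrow> int poly" where
  "cofactor A a = prod_mset (image_mset geometric_poly (A - {#a#}))"

lemma cofactor_nth:
  assumes "i < length \<alpha>"
  shows "cofactor (mset \<alpha>) (\<alpha> ! i) = (\<Prod>j\<in>{..<length \<alpha>} - {i}. geometric_poly (\<alpha> ! j))"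
proof -
  have "mset \<alpha> = image_mset ((!) \<alpha>) (mset_set {..<length \<alpha>})"
    by (metis atLeast0LessThan map_nth mset_map mset_upt)
  also have "\<dots> = add_mset (\<alpha> ! i) (image_mset ((!) \<alpha>) (mset_set ({..<length \<alpha>} - {i})))"
    using assms by (simp add: mset_set.remove[of "{..<length \<alpha>}" i])
  finally show ?thesis
    by (simp add: cofactor_def multiset.map_comp comp_def prod_unfold_prod_mset)
qed

lemma geometric_poly_mult_cofactor:
  assumes "a \<in># A"
  shows "geometric_poly a * cofactor A a = prod_mset (image_mset geometric_poly A)"
  using insert_DiffM[OF assms] by (metis cofactor_def image_mset_add_mset prod_mset.add_mset)

lemma coeff_0_cofactor:
  assumes "\<And>a. a \<in># A \<Longrightarrow> 0 < a"
  shows "coeff (cofactor A a) 0 = 1"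
proof -
  have "coeff (prod_mset (image_mset geometric_poly B)) 0 = 1" if "\<And>a. a \<in># B \<Longrightarrow> 0 < a" for B
    using that by (induction B) (auto simp: mult.commute coeff_mult_0 coeff_geometric_poly_0)
  then show ?thesis
    using assms in_diffD unfolding cofactor_def by metis
qed

text \<open>With \<open>P\<close> the product over \<open>A\<close>,
  \<open>(1 - q) P = (1 - q^a) cofactor A a\<close>. Up to degree \<open>a\<close>, the factor
  \<open>1 - q^a\<close> changes only the coefficient in degree \<open>a\<close>, by the constant
  coefficient 1.\<close>

lemma coeff_cofactor:
  assumes a: "a \<in># A" and pos: "\<And>a. a \<in># A \<Longrightarrow> 0 < a" and "k \<le> a"
  shows "coeff (cofactor A a) k =
    coeff ((1 - monom 1 1) * prod_mset (image_mset geometric_poly A)) k + (if k = a then 1 else 0)"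
proof -
  have "(1 - monom 1 1) * prod_mset (image_mset geometric_poly A) = (1 - monom 1 a) * cofactor A a"
    unfolding geometric_poly_mult_cofactor[OF a, symmetric] mult.assoc[symmetric] geometric_poly_eq ..
  also have "coeff \<dots> k = coeff (cofactor A a) k - (if k = a then 1 else 0)"
    using \<open>k \<le> a\<close> coeff_0_cofactor[OF pos] by (simp add: algebra_simps coeff_monom_mult)
  finally show ?thesis
    by simp
qed

definition symmetric_part :: "nat multiset \<Rightarrow> int poly" where
  "symmetric_part A = of_nat (size A) * prod_mset (image_mset geometric_poly A) -
     sum_mset (image_mset (cofactor A) A)"

lemma card_ribbon_parameters:
  assumes pos: "\<And>i. i < length \<alpha> \<Longrightarrow> 0 < \<alpha> ! i" and ne: "\<alpha> \<noteq> []"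
  shows "int (card (ribbon_parameters \<alpha> k)) =
    coeff (symmetric_part (mset \<alpha>) + cofactor (mset \<alpha>) (hd \<alpha>) +
           monom 1 (last \<alpha>) * cofactor (mset \<alpha>) (last \<alpha>)) k"
proof -
  define n where "n = length \<alpha> - 1"
  have len: "length \<alpha> = Suc n"
    using ne by (simp add: n_def)
  let ?I = "{..<length \<alpha>}"
  let ?g = "\<lambda>i. geometric_poly (\<alpha> ! i)"
  let ?c = "\<lambda>i. cofactor (mset \<alpha>) (\<alpha> ! i)"
  define P where "P = prod_mset (image_mset geometric_poly (mset \<alpha>))"
  have P: "?g i * ?c i = P" if "i \<in> ?I" for i
    unfolding P_def by (rule geometric_poly_mult_cofactor) (use that in simp)
  have fin: "finite (row_choices \<alpha> q i)" for q i
    by (simp add: row_choices_def)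
  have factor: "(\<Prod>i\<in>?I. \<Sum>b\<in>row_choices \<alpha> q i. monom 1 b) =
      (if q = n then P + monom 1 (\<alpha> ! n) * ?c n else P - ?c (Suc q))" if q: "q \<in> ?I" for q
  proof -
    \<comment> \<open>The only row whose choices differ from \<open>{..<\<alpha> ! i}\<close>: row
      \<open>Suc q\<close> loses the value 0, or the last row \<open>q = n\<close> gains the value
      \<open>\<alpha> ! n\<close>.\<close>
    define i where "i = (if q = n then q else Suc q)"
    have i: "i \<in> ?I"
      using q by (auto simp: i_def len)
    have "(\<Prod>i\<in>?I. \<Sum>b\<in>row_choices \<alpha> q i. monom 1 b) =
        (\<Sum>b\<in>row_choices \<alpha> q i. monom 1 b) * (\<Prod>j\<in>?I - {i}. \<Sum>b\<in>row_choices \<alpha> q j. monom 1 b)"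
      using i by (simp add: prod.remove)
    also have "(\<Prod>j\<in>?I - {i}. \<Sum>b\<in>row_choices \<alpha> q j. monom 1 b) = (\<Prod>j\<in>?I - {i}. ?g j)"
      using q pos by (intro prod.cong) (auto simp: sum_monom_row_choices i_def len split: if_splits)
    also have "\<dots> = ?c i"
      using i by (simp add: cofactor_nth)
    also have "(\<Sum>b\<in>row_choices \<alpha> q i. monom 1 b) = (if q = n then ?g n + monom 1 (\<alpha> ! n) else ?g (Suc q) - 1)"
      using i pos[of i] by (simp add: sum_monom_row_choices) (auto simp: i_def len)
    finally show ?thesis
      using P[OF i] by (auto simp: i_def algebra_simps)
  qed
  have "int (card (ribbon_parameters \<alpha> k)) =
      (\<Sum>q\<in>?I. int (card {x \<in> PiE ?I (row_choices \<alpha> q). (\<Sum>i\<in>?I. x i) = k}))"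
    unfolding ribbon_parameters_def
  proof (subst card_SigmaI)
    have "finite (PiE ?I (row_choices \<alpha> q))" for q
      by (rule finite_PiE) (simp_all add: fin)
    then show "\<forall>q\<in>?I. finite {x \<in> PiE ?I (row_choices \<alpha> q). (\<Sum>i\<in>?I. x i) = k}"
      by auto
  qed simp_all
  also have "\<dots> = coeff (\<Sum>q\<in>?I. \<Prod>i\<in>?I. \<Sum>b\<in>row_choices \<alpha> q i. monom 1 b) k"
    by (simp add: card_PiE_sum_eq[OF _ fin] coeff_sum)
  also have "(\<Sum>q\<in>?I. \<Prod>i\<in>?I. \<Sum>b\<in>row_choices \<alpha> q i. monom 1 b) =
      (\<Sum>q<n. P - ?c (Suc q)) + (P + monom 1 (\<alpha> ! n) * ?c n)"
    using factor by (simp add: len)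
  \<comment> \<open>The cofactors of all rows but the top one are subtracted; completing the sum
    leaves \<open>?c 0\<close> as a correction.\<close>
  also have "\<dots> = of_nat (length \<alpha>) * P - (\<Sum>q\<in>?I. ?c q) + ?c 0 + monom 1 (\<alpha> ! n) * ?c n"
    unfolding len sum.lessThan_Suc_shift by (simp add: sum_subtractf algebra_simps)
  also have "(\<Sum>q\<in>?I. ?c q) = sum_mset (image_mset (cofactor (mset \<alpha>)) (mset \<alpha>))"
    by (simp add: sum_mset_sum_list sum_list_sum_nth atLeast0LessThan flip: mset_map)
  finally show ?thesis
    using ne by (simp add: symmetric_part_def P_def hd_conv_nth last_conv_nth n_def)
qed

section \<open>Comparison of the two ends\<close>

text \<open>
  For \<open>k \<le> a\<close> the coefficients of \<open>cofactor A a\<close> are those of a polynomial independent of \<open>a\<close>,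
  except for an extra \<open>1\<close> at \<open>k = a\<close>; so the smallest part in which the two ends differ decides.
\<close>

lemma end_coefficients_less:
  assumes pos: "\<And>a. a \<in># A \<Longrightarrow> 0 < a" and A: "a \<in># A" "a' \<in># A"
    and le: "a \<le> b" "a' \<le> b'" and less: "a' < a \<or> a = a' \<and> b' < b"
    and k: "k = (if a' < a then a' else b')"
  shows "coeff (cofactor A a + monom 1 b * cofactor A b) k <
    coeff (cofactor A a' + monom 1 b' * cofactor A b') k"
proof (cases "a' < a")
  \<comment> \<open>Here \<open>k = a' < a \<le> b\<close>: the first summand has its extra 1 for
    \<open>a'\<close> but not for \<open>a\<close>, and the shift by \<open>b\<close> contributes
    nothing.\<close>
  case True
  then show ?thesis
    using le coeff_cofactor[OF A(1) pos, of k] coeff_cofactor[OF A(2) pos, of k] coeff_0_cofactor[OF pos, of A b']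
    by (simp add: k coeff_monom_mult)
next
  \<comment> \<open>The cofactors of \<open>a = a'\<close> agree; in degree
    \<open>k = b' < b\<close> only the shift by \<open>b'\<close> contributes, with constant
    coefficient 1.\<close>
  case False
  then show ?thesis
    using less coeff_0_cofactor[OF pos, of A b'] by (simp add: k coeff_monom_mult)
qed

section \<open>Evaluation on ribbons and the final contradiction\<close>

lemma length_le_sum_list:
  fixes xs :: "nat list"
  assumes "\<forall>x\<in>set xs. 0 < x"
  shows "length xs \<le> sum_list xs"
  using assms by (induction xs) auto

text \<open>The other \<open>R - 1\<close> parts are at least 1 each. So every part is admissible as
  the multiplicity \<open>k\<close> in \<open>ribbon_content\<close>.\<close>

lemma part_le_size:
  assumes "\<beta> \<in> compositions R N" "k \<in> set \<beta>"
  shows "R - 1 + k \<le> N"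
proof -
  obtain xs ys where "\<beta> = xs @ k # ys"
    using assms(2) by (meson split_list)
  then show ?thesis
    using assms(1) length_le_sum_list[of xs] length_le_sum_list[of ys] by (auto simp: compositions_def)
qed

lemma set_ribbon_content:
  "t \<in># ribbon_content R N k \<Longrightarrow> 0 < R \<Longrightarrow> 0 < t"
  "t \<in> {1..<R} \<Longrightarrow> t \<in># ribbon_content R N k"
  by (auto simp: ribbon_content_def split: if_splits)

lemma descent_functional_ribbon_schur:
  assumes \<alpha>: "\<alpha> \<in> compositions R N" and R: "0 < R" and k: "R - 1 + k \<le> N"
  shows "descent_functional (ribbon_content R N k) {1..<R - 1} (ribbon_schur \<alpha>) =
    of_int (coeff (symmetric_part (mset \<alpha>) + cofactor (mset \<alpha>) (hd \<alpha>) +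
      monom 1 (last \<alpha>) * cofactor (mset \<alpha>) (last \<alpha>)) k)"
proof -
  have len: "length \<alpha> = R" "sum_list \<alpha> = N" and pos: "\<And>i. i < length \<alpha> \<Longrightarrow> 0 < \<alpha> ! i"
    using \<alpha> by (auto simp: compositions_def)
  have "descent_functional (ribbon_content R N k) {1..<R - 1} (ribbon_schur \<alpha>) =
      real (card (ribbon_descent_tableaux \<alpha> k))"
    unfolding ribbon_schur_def ribbon_descent_tableaux_def len
  proof (rule descent_functional_tableau_series)
    show "t \<in># ribbon_content R N k \<and> Suc t \<in># ribbon_content R N k" if "t \<in> {1..<R - 1}" for t
      using that by (intro conjI set_ribbon_content(2)) auto
    show "0 \<notin># ribbon_content R N k"
      using set_ribbon_content(1)[of 0 R N k] R by blast
  qed (simp_all add: finite_ribbon_diagram)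
  also have "card (ribbon_descent_tableaux \<alpha> k) = card (ribbon_parameters \<alpha> k)"
    using card_ribbon_descent_tableaux[OF pos] R k len by simp
  also have "real (card (ribbon_parameters \<alpha> k)) = of_int (int (card (ribbon_parameters \<alpha> k)))"
    by simp
  also have "int (card (ribbon_parameters \<alpha> k)) =
      coeff (symmetric_part (mset \<alpha>) + cofactor (mset \<alpha>) (hd \<alpha>) +
        monom 1 (last \<alpha>) * cofactor (mset \<alpha>) (last \<alpha>)) k"
    by (rule card_ribbon_parameters[OF pos]) (use R len in auto)
  finally show ?thesis .
qed

theorem theorem3p19:
  fixes \<alpha> \<beta> :: "nat list" and R N :: nat
  assumes "\<alpha> \<in> compositions R N" and "\<beta> \<in> compositions R N"
    and "\<alpha> \<noteq> replicate R 1"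
    and "sort_partition \<alpha> = sort_partition \<beta>"
    and "hd \<alpha> \<le> last \<alpha>" and "hd \<beta> \<le> last \<beta>"
    and "schur_positive (ribbon_schur \<alpha> - ribbon_schur \<beta>)"
  shows "hd \<alpha> < hd \<beta> \<or> (hd \<alpha> = hd \<beta> \<and> last \<alpha> \<le> last \<beta>)"
proof (rule ccontr)
  assume neg: "\<not> (hd \<alpha> < hd \<beta> \<or> (hd \<alpha> = hd \<beta> \<and> last \<alpha> \<le> last \<beta>))"
  define k where "k = (if hd \<beta> < hd \<alpha> then hd \<beta> else last \<beta>)"
  let ?M = "ribbon_content R N k"
  \<comment> \<open>For \<open>R = 0\<close> the only composition is empty and equals
    \<open>replicate R 1\<close>.\<close>
  have R: "0 < R"
    using assms(1,3) by (cases R) (auto simp: compositions_def)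
  have ne: "\<alpha> \<noteq> []" "\<beta> \<noteq> []"
    using R assms(1,2) by (auto simp: compositions_def)
  have mset: "mset \<alpha> = mset \<beta>"
    using assms(4) unfolding sort_partition_def by (metis mset_rev mset_sort)
  have k: "R - 1 + k \<le> N"
    by (rule part_le_size[OF assms(2)]) (use ne in \<open>auto simp: k_def\<close>)
  have "0 \<le> descent_functional ?M {1..<R - 1} (ribbon_schur \<alpha> - ribbon_schur \<beta>)"
  proof (rule descent_functional_schur_positive[OF assms(7)])
    show "t \<in># ?M \<and> Suc t \<in># ?M" if "t \<in> {1..<R - 1}" for t
      using that by (intro conjI set_ribbon_content(2)) auto
    show "0 \<notin># ?M"
      using set_ribbon_content(1)[of 0 R N k] R by blast
  qed simp
  \<comment> \<open>The symmetric parts depend only on the common multiset of parts and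
    cancel.\<close>
  then have "coeff (cofactor (mset \<beta>) (hd \<beta>) + monom 1 (last \<beta>) * cofactor (mset \<beta>) (last \<beta>)) k \<le>
      coeff (cofactor (mset \<beta>) (hd \<alpha>) + monom 1 (last \<alpha>) * cofactor (mset \<beta>) (last \<alpha>)) k"
    unfolding descent_functional_diff descent_functional_ribbon_schur[OF assms(1) R k]
      descent_functional_ribbon_schur[OF assms(2) R k] mset by simp
  moreover have "coeff (cofactor (mset \<beta>) (hd \<alpha>) + monom 1 (last \<alpha>) * cofactor (mset \<beta>) (last \<alpha>)) k <
      coeff (cofactor (mset \<beta>) (hd \<beta>) + monom 1 (last \<beta>) * cofactor (mset \<beta>) (last \<beta>)) k"
  proof (rule end_coefficients_less[OF _ _ _ assms(5,6) _ k_def])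
    show "0 < a" if "a \<in># mset \<beta>" for a
      using that assms(2) by (auto simp: compositions_def)
    have "hd \<alpha> \<in># mset \<alpha>"
      using ne by simp
    then show "hd \<alpha> \<in># mset \<beta>"
      unfolding mset .
    show "hd \<beta> \<in># mset \<beta>"
      using ne by simp
    show "hd \<beta> < hd \<alpha> \<or> hd \<alpha> = hd \<beta> \<and> last \<beta> < last \<alpha>"
      using neg by linarith
  qed
  ultimately show False
    by simp
qed

end
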